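(* Let $(G,\mathcal{R})$ be a framed directed graph. Then $p\mapsto\mathcal{I}(p)$ is a bijection from elementary routes of $(G,\mathcal{R})$ to vertices of $\mathcal F_1(G)$, and $B\mapsto\mathcal{I}(B)$ is a bijection from self-compatible elementary bands of $(G,\mathcal{R})$ to the extremal rays of $\mathcal F_1(G)$.
   Context: $G$ is a finite directed graph (edge set $E$); each edge $e$ has tail $t(e)$ and head $h(e)$; $\mathrm{in}(v)$, $\mathrm{out}(v)$ are the incoming/outgoing edges at $v$. A vertex is a source if $\mathrm{in}(v)=\emptyset$, a sink if $\mathrm{out}(v)=\emptyset$, internal otherwise. A flow is $F:E\to\mathbb R$ with $\sum_{e\in\mathrm{in}(v)}F(e)=\sum_{e\in\mathrm{out}(v)}F(e)$ at every internal $v$; $\mathcal F_1(G)$ is the set of nonnegative flows with $\sum_{e \text{ out of a source}}F(e)=1$. A framing $\mathcal R$ assigns, at each internal vertex $v$, a linear order to $\mathrm{in}(v)$ and one to $\mathrm{out}(v)$. A route is a directed path from a source to a sink; a band is a directed closed walk $e_1\cdots e_m$ ($h(e_m)=t(e_1)$) not a power of a shorter one, up to cyclic rotation; subpaths of a band are subpaths of its powers; a trail is a route or band. $\mathcal I(p)\in\mathbb R^E$ counts the number of traversals of each edge. An incompatibility is a pair $(e_1Rf_2,e_2Rf_1)$ where $R$ is a (possibly empty) directed path from internal $v$ to internal $w$, $e_1<e_2$ in $\mathrm{in}(v)$ and $f_1<f_2$ in $\mathrm{out}(w)$. Trails $p,q$ are incompatible if there are subpaths $p'$ of $p$ and $q'$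 of $q$ with $(p',q')$ an incompatibility; otherwise compatible; self-compatible means compatible with itself. A route or band is simple if it visits no vertex twice. An elementary route is a self-compatible simple route; an elementary band is a simple band. Extremal rays of a pointed polyhedron are the elements (up to positive scaling) of a minimal generating set of its recession cone. *)

theory Defs
  imports "HOL-Analysis.Analysis" "HOL-Library.Sublist" "Graph_Theory.Digraph" "Graph_Theory.Arc_Walk"
begin

definition source :: "('a, 'b) pre_digraph \<Rightarrow> 'a \<Rightarrow> bool" where
  "source G v \<longleftrightarrow> v \<in> verts G \<and> in_arcs G v = {}"

definition sink :: "('a, 'b) pre_digraph \<Rightarrow> 'a \<Rightarrow> bool" where
  "sink G v \<longleftrightarrow> v \<in> verts G \<and> out_arcs G v = {}"

definition internal :: "('a, 'b) pre_digraph \<Rightarrow> 'a \<Rightarrow> bool" where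
  "internal G v \<longleftrightarrow> v \<in> verts G \<and> \<not> source G v \<and> \<not> sink G v"

section \<open>Flows\<close>

text \<open>
  The space of real functions on the edge set of a finite digraph with edges drawn from a finite type
  \<open>'b\<close> is the coordinate subspace of \<open>real ^ 'b\<close> of vectors vanishing off \<open>arcs G\<close>.
  Every finite digraph, also one without edges, arises this way.
\<close>

definition flow :: "('a, 'b::finite) pre_digraph \<Rightarrow> real ^ 'b \<Rightarrow> bool" where
  "flow G F \<longleftrightarrow> (\<forall>e. e \<notin> arcs G \<longrightarrow> F $ e = 0) \<and>
     (\<forall>v. internal G v \<longrightarrow> (\<Sum>e\<in>in_arcs G v. F $ e) = (\<Sum>e\<in>out_arcs G v. F $ e))"

definition source_arcs :: "('a, 'b) pre_digraph \<Rightarrow> 'b set" where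
  "source_arcs G = {e \<in> arcs G. source G (tail G e)}"

definition unit_flows :: "('a, 'b::finite) pre_digraph \<Rightarrow> (real ^ 'b) set" where
  "unit_flows G = {F. flow G F \<and> (\<forall>e. 0 \<le> F $ e) \<and> (\<Sum>e\<in>source_arcs G. F $ e) = 1}"

section \<open>Recession cones and extremal rays\<close>

text \<open>
  A polyhedron is the solution set of a finite system of inequalities \<open>a \<bullet> x \<le> b\<close>, given
  here as a set of pairs \<open>(a, b)\<close>; its recession cone is the solution set of the homogenised
  system \<open>a \<bullet> x \<le> 0\<close>. If the polyhedron is nonempty, this depends on the polyhedron only
  (lemma \<open>recession_cone_eq\<close>). The system matters only for an empty polyhedron; the polyhedron
  of unit flows is empty for instance if \<open>G\<close> is a directed cycle.
\<close>

definition polyhedron_of :: "('v::real_inner \<times> real) set \<Rightarrow> 'v set" where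
  "polyhedron_of A = {x. \<forall>(a, b)\<in>A. a \<bullet> x \<le> b}"

definition recession_cone :: "('v::real_inner \<times> real) set \<Rightarrow> 'v set" where
  "recession_cone A = {x. \<forall>(a, b)\<in>A. a \<bullet> x \<le> 0}"

lemma recession_cone_eq:
  assumes "polyhedron_of A \<noteq> {}"
  shows "recession_cone A =
    {d. \<forall>x\<in>polyhedron_of A. \<forall>t\<ge>0. x + t *\<^sub>R d \<in> polyhedron_of A}" (is "_ = ?C")
proof (intro equalityI subsetI)
  fix d assume d: "d \<in> recession_cone A"
  have "a \<bullet> (x + t *\<^sub>R d) \<le> b"
    if "(a, b) \<in> A" "x \<in> polyhedron_of A" "t \<ge> 0" for a b x t
  proof -
    have "a \<bullet> d \<le> 0" "a \<bullet> x \<le> b"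
      using d that by (auto simp: recession_cone_def polyhedron_of_def)
    moreover from this have "t * (a \<bullet> d) \<le> 0"
      using that(3) by (simp add: mult_nonneg_nonpos)
    ultimately show ?thesis by (simp add: inner_add_right)
  qed
  then show "d \<in> ?C" by (auto simp: polyhedron_of_def)
next
  fix d assume d: "d \<in> ?C"
  obtain x where x: "x \<in> polyhedron_of A" using assms by auto
  have "a \<bullet> d \<le> 0" if ab: "(a, b) \<in> A" for a b
  proof (rule ccontr)
    assume "\<not> a \<bullet> d \<le> 0"
    then have pos: "a \<bullet> d > 0" by simp
    define t where "t = (b - a \<bullet> x + 1) / (a \<bullet> d)"
    have "a \<bullet> x \<le> b" using x ab by (auto simp: polyhedron_of_def)
    then have "t \<ge> 0" using pos by (simp add: t_def)
    then have "x + t *\<^sub>R d \<in> polyhedron_of A" using d x by blast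
    then have "a \<bullet> x + t * (a \<bullet> d) \<le> b"
      using ab by (auto simp: polyhedron_of_def inner_add_right)
    moreover have "t * (a \<bullet> d) = b - a \<bullet> x + 1" using pos by (simp add: t_def)
    ultimately show False by simp
  qed
  then show "d \<in> recession_cone A" by (auto simp: recession_cone_def)
qed

definition minimal_generating_set :: "'v::real_vector set \<Rightarrow> 'v set \<Rightarrow> bool" where
  "minimal_generating_set C S \<longleftrightarrow>
     convex_cone hull S = C \<and> (\<forall>T. T \<subset> S \<longrightarrow> convex_cone hull T \<noteq> C)"

text \<open>An element of a generating set up to positive scaling is represented by its open ray.\<close>

definition ray :: "'v::real_vector \<Rightarrow> 'v set" where
  "ray d = {c *\<^sub>R d | c. c > 0}"

definition extremal_rays :: "'v::real_vector set \<Rightarrow> 'v set set" where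
  "extremal_rays C = {ray d | d S. minimal_generating_set C S \<and> d \<in> S}"

definition conservation :: "('a, 'b::finite) pre_digraph \<Rightarrow> 'a \<Rightarrow> real ^ 'b" where
  "conservation G v = (\<Sum>e\<in>in_arcs G v. axis e 1) - (\<Sum>e\<in>out_arcs G v. axis e 1)"

definition source_total :: "('a, 'b::finite) pre_digraph \<Rightarrow> real ^ 'b" where
  "source_total G = (\<Sum>e\<in>source_arcs G. axis e 1)"

text \<open>Equations are written as pairs of opposite inequalities.\<close>

definition flow_system :: "('a, 'b::finite) pre_digraph \<Rightarrow> ((real ^ 'b) \<times> real) set" where
  "flow_system G =
     {(- axis e 1, 0) | e. True} \<union> {(axis e 1, 0) | e. e \<notin> arcs G} \<union>
     {(conservation G v, 0) | v. internal G v} \<union> {(- conservation G v, 0) | v. internal G v} \<union>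
     {(source_total G, 1), (- source_total G, - 1)}"

lemma inner_conservation:
  "conservation G v \<bullet> F = (\<Sum>e\<in>in_arcs G v. F $ e) - (\<Sum>e\<in>out_arcs G v. F $ e)"
  by (simp add: conservation_def inner_diff_left inner_sum_left inner_axis')

lemma inner_source_total: "source_total G \<bullet> F = (\<Sum>e\<in>source_arcs G. F $ e)"
  by (simp add: source_total_def inner_sum_left inner_axis')

lemma polyhedron_of_flow_system:
  fixes G :: "('a, 'b::finite) pre_digraph"
  shows "polyhedron_of (flow_system G) = unit_flows G"
proof (rule set_eqI)
  fix F :: "real ^ 'b"
  have "F \<in> polyhedron_of (flow_system G) \<longleftrightarrow>
      (\<forall>e. - axis e 1 \<bullet> F \<le> 0) \<and> (\<forall>e. e \<notin> arcs G \<longrightarrow> axis e 1 \<bullet> F \<le> 0) \<and>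
      (\<forall>v. internal G v \<longrightarrow> conservation G v \<bullet> F \<le> 0) \<and>
      (\<forall>v. internal G v \<longrightarrow> - conservation G v \<bullet> F \<le> 0) \<and>
      source_total G \<bullet> F \<le> 1 \<and> - source_total G \<bullet> F \<le> - 1"
    unfolding polyhedron_of_def flow_system_def by blast
  then show "F \<in> polyhedron_of (flow_system G) \<longleftrightarrow> F \<in> unit_flows G"
    unfolding unit_flows_def flow_def
    by (auto simp: inner_conservation inner_source_total inner_axis' intro: antisym)
qed

lemma finite_flow_system:
  fixes G :: "('a, 'b::finite) pre_digraph"
  assumes "fin_digraph G"
  shows "finite (flow_system G)"
proof -
  have "finite {v. internal G v}"
    by (rule finite_subset[OF _ fin_digraph.finite_verts[OF assms]]) (auto simp: internal_def)
  moreover have "finite {(- axis e 1 :: real ^ 'b, 0::real) | e. True}"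
    by (rule finite_subset[of _ "range (\<lambda>e. (- axis e 1, 0))"]) auto
  ultimately show ?thesis by (simp add: flow_system_def)
qed

section \<open>Framings, routes and bands\<close>

text \<open>The orders are reflexive relations, as in the library's \<^const>\<open>linear_order_on\<close>; their
  values at vertices that are not internal are irrelevant.\<close>

record ('a, 'b) framing =
  in_order :: "'a \<Rightarrow> 'b rel"
  out_order :: "'a \<Rightarrow> 'b rel"

definition is_framing :: "('a, 'b) pre_digraph \<Rightarrow> ('a, 'b) framing \<Rightarrow> bool" where
  "is_framing G R \<longleftrightarrow> (\<forall>v. internal G v \<longrightarrow>
     linear_order_on (in_arcs G v) (in_order R v) \<and>
     linear_order_on (out_arcs G v) (out_order R v))"

definition less_wrt :: "'b rel \<Rightarrow> 'b \<Rightarrow> 'b \<Rightarrow> bool" where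
  "less_wrt r x y \<longleftrightarrow> (x, y) \<in> r \<and> x \<noteq> y"

text \<open>A route is nonempty, which excludes the trivial walk at an isolated vertex.\<close>

definition route :: "('a, 'b) pre_digraph \<Rightarrow> 'b list \<Rightarrow> bool" where
  "route G p \<longleftrightarrow> p \<noteq> [] \<and> (\<exists>u v. source G u \<and> sink G v \<and> pre_digraph.awalk G u p v)"

definition closed_walk :: "('a, 'b) pre_digraph \<Rightarrow> 'b list \<Rightarrow> bool" where
  "closed_walk G p \<longleftrightarrow> p \<noteq> [] \<and> (\<exists>u. pre_digraph.awalk G u p u)"

definition list_power :: "'b list \<Rightarrow> nat \<Rightarrow> 'b list" where
  "list_power p n = concat (replicate n p)"

definition primitive_closed_walk :: "('a, 'b) pre_digraph \<Rightarrow> 'b list \<Rightarrow> bool" where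
  "primitive_closed_walk G p \<longleftrightarrow> closed_walk G p \<and>
     \<not> (\<exists>q n. closed_walk G q \<and> length q < length p \<and> p = list_power q n)"

definition band :: "('a, 'b) pre_digraph \<Rightarrow> 'b list set \<Rightarrow> bool" where
  "band G B \<longleftrightarrow> (\<exists>p. primitive_closed_walk G p \<and> B = {rotate k p | k. True})"

text \<open>Routes are edge lists; a band is the set of all rotations of a closed walk.\<close>

datatype 'b trail = Route "'b list" | Band "'b list set"

fun is_trail :: "('a, 'b) pre_digraph \<Rightarrow> 'b trail \<Rightarrow> bool" where
  "is_trail G (Route p) \<longleftrightarrow> route G p"
| "is_trail G (Band B) \<longleftrightarrow> band G B"

fun subpaths :: "'b trail \<Rightarrow> 'b list set" where
  "subpaths (Route p) = {s. sublist s p}"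
| "subpaths (Band B) = {s. \<exists>p\<in>B. \<exists>n. sublist s (list_power p n)}"

text \<open>All rotations of a closed walk traverse each edge equally often, so the choice is immaterial.\<close>

fun traversals :: "'b::finite trail \<Rightarrow> real ^ 'b" where
  "traversals (Route p) = (\<chi> e. real (count_list p e))"
| "traversals (Band B) = (\<chi> e. real (count_list (SOME p. p \<in> B) e))"

definition incompatibility ::
    "('a, 'b) pre_digraph \<Rightarrow> ('a, 'b) framing \<Rightarrow> 'b list \<Rightarrow> 'b list \<Rightarrow> bool" where
  "incompatibility G R p q \<longleftrightarrow> (\<exists>v w r e1 e2 f1 f2.
     internal G v \<and> internal G w \<and> pre_digraph.awalk G v r w \<and>
     e1 \<in> in_arcs G v \<and> e2 \<in> in_arcs G v \<and> less_wrt (in_order R v) e1 e2 \<and>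
     f1 \<in> out_arcs G w \<and> f2 \<in> out_arcs G w \<and> less_wrt (out_order R w) f1 f2 \<and>
     p = e1 # r @ [f2] \<and> q = e2 # r @ [f1])"

definition incompatible ::
    "('a, 'b) pre_digraph \<Rightarrow> ('a, 'b) framing \<Rightarrow> 'b trail \<Rightarrow> 'b trail \<Rightarrow> bool" where
  "incompatible G R P Q \<longleftrightarrow> (\<exists>p\<in>subpaths P. \<exists>q\<in>subpaths Q. incompatibility G R p q)"

definition self_compatible ::
    "('a, 'b) pre_digraph \<Rightarrow> ('a, 'b) framing \<Rightarrow> 'b trail \<Rightarrow> bool" where
  "self_compatible G R P \<longleftrightarrow> \<not> incompatible G R P P"

text \<open>A closed walk is listed by the tails of its edges, so that its base point counts once.\<close>

fun simple :: "('a, 'b) pre_digraph \<Rightarrow> 'b trail \<Rightarrow> bool" where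
  "simple G (Route p) \<longleftrightarrow> distinct (pre_digraph.awalk_verts G (tail G (hd p)) p)"
| "simple G (Band B) \<longleftrightarrow> (\<forall>p\<in>B. distinct (map (tail G) p))"

definition elementary_routes ::
    "('a, 'b) pre_digraph \<Rightarrow> ('a, 'b) framing \<Rightarrow> 'b trail set" where
  "elementary_routes G R =
     {Route p | p. is_trail G (Route p) \<and> simple G (Route p) \<and> self_compatible G R (Route p)}"

definition elementary_bands :: "('a, 'b) pre_digraph \<Rightarrow> 'b trail set" where
  "elementary_bands G = {Band B | B. is_trail G (Band B) \<and> simple G (Band B)}"

end

theory Submission
  imports Defs
begin

text \<open>
  A flow supported on a simple route or a simple closed walk is constant along it, and the support
  of every nonzero nonnegative flow contains the edges of a simple route or of a simple closed walk:
  take a walk in the support that is as long as possible among those without repeated tails.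
  Subtracting the largest possible multiple of the trail found shows that simple closed walks
  generate the recession cone and that an extreme point is the vector of a simple route. The
  framing plays no role, since a simple trail enters each vertex through at most one edge
  and hence is self-compatible.
\<close>

section \<open>Extremal rays\<close>

lemma ray_self: "d \<in> ray d"
  unfolding ray_def by (rule CollectI, rule exI[of _ 1]) simp

lemma ray_eqI:
  assumes "d \<in> ray e"
  shows "ray d = ray e"
proof -
  obtain c where c: "c > 0" "d = c *\<^sub>R e" using assms by (auto simp: ray_def)
  show ?thesis
  proof (intro equalityI subsetI)
    fix x assume "x \<in> ray d"
    then obtain a where "a > 0" "x = (a * c) *\<^sub>R e" by (auto simp: ray_def c)
    then show "x \<in> ray e" using c(1) by (auto simp: ray_def intro!: exI[of _ "a * c"])
  next
    fix x assume "x \<in> ray e"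
    then obtain a where "a > 0" "x = a *\<^sub>R e" by (auto simp: ray_def)
    then show "x \<in> ray d" using c by (auto simp: ray_def intro!: exI[of _ "a / c"])
  qed
qed

text \<open>If \<open>C\<close> without the ray of \<open>e\<close> is still a convex cone, a set
  avoiding that ray cannot generate \<open>C\<close>. Every generating set therefore meets the ray
  of each \<open>e\<close>, which makes \<open>E\<close> minimal and pins down all other minimal
  generating sets up to scaling.\<close>

lemma extremal_rays_eqI:
  fixes E :: "'v::real_vector set"
  assumes gen: "convex_cone hull E = C"
    and inj: "inj_on ray E"
    and ext: "\<And>e. e \<in> E \<Longrightarrow> convex_cone (C - ray e)"
  shows "extremal_rays C = ray ` E"
proof -
  have EC: "E \<subseteq> C" using hull_subset[of E convex_cone] gen by simp
  have meets: "\<exists>d\<in>S. d \<in> ray e" if "convex_cone hull S = C" "e \<in> E" for S e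
  proof (rule ccontr)
    assume "\<not> ?thesis"
    then have "S \<subseteq> C - ray e" using hull_subset[of S convex_cone] unfolding that(1) by blast
    then have "C \<subseteq> C - ray e"
      using hull_minimal[of S "C - ray e" convex_cone] ext[OF that(2)] that(1) by simp
    then show False using EC that(2) ray_self[of e] by blast
  qed
  have min: "minimal_generating_set C E"
    unfolding minimal_generating_set_def
  proof (intro conjI allI impI gen notI)
    fix T assume T: "T \<subset> E" "convex_cone hull T = C"
    then obtain e where e: "e \<in> E" "e \<notin> T" by blast
    obtain d where d: "d \<in> T" "d \<in> ray e" using meets[OF T(2) e(1)] by blast
    have "d = e" using inj ray_eqI[OF d(2)] d(1) e(1) T(1) by (auto simp: inj_on_def)
    then show False using d(1) e(2) by simp
  qed
  show ?thesis
  proof (intro equalityI subsetI)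
    fix r assume "r \<in> extremal_rays C"
    then obtain d S where S: "minimal_generating_set C S" "d \<in> S" "r = ray d"
      by (auto simp: extremal_rays_def)
    then have hS: "convex_cone hull S = C" by (simp add: minimal_generating_set_def)
    \<comment> \<open>\<open>g\<close> picks from \<open>S\<close> one representative of each ray.
      These representatives already generate \<open>C\<close>, so minimality of \<open>S\<close>
      leaves no room for further elements.\<close>
    obtain g where g: "\<And>e. e \<in> E \<Longrightarrow> g e \<in> S \<and> g e \<in> ray e"
      using meets[OF hS] by metis
    have "E \<subseteq> convex_cone hull (g ` E)"
    proof
      fix e assume e: "e \<in> E"
      then have "e \<in> ray (g e)" using g[OF e] ray_eqI[of "g e" e] ray_self[of e] by simp
      then obtain c where "c > 0" "e = c *\<^sub>R g e" by (auto simp: ray_def)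
      moreover have "g e \<in> convex_cone hull (g ` E)" using e by (simp add: hull_inc)
      ultimately show "e \<in> convex_cone hull (g ` E)"
        using convex_cone_hull_mul[of "g e" "g ` E" c] by simp
    qed
    then have "convex_cone hull E \<subseteq> convex_cone hull (g ` E)"
      by (intro hull_minimal convex_cone_convex_cone_hull)
    moreover have "convex_cone hull (g ` E) \<subseteq> convex_cone hull S"
      using g by (intro hull_mono) blast
    ultimately have "convex_cone hull (g ` E) = C" by (simp only: gen hS subset_antisym)
    then have "\<not> g ` E \<subset> S" using S(1) unfolding minimal_generating_set_def by blast
    then have "d \<in> g ` E" using g S(2) by blast
    then show "r \<in> ray ` E" using g ray_eqI S(3) by blast
  next
    fix r assume "r \<in> ray ` E"
    then show "r \<in> extremal_rays C" using min by (auto simp: extremal_rays_def)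
  qed
qed

section \<open>Walks without repeated vertices\<close>

lemma set_list_power_subset: "set (list_power p n) \<subseteq> set p"
  by (auto simp: list_power_def)

lemma count_list_rotate:
  fixes p :: "'a list"
  shows "count_list (rotate k p) = count_list p"
proof -
  have "count_list (rotate1 q) = count_list q" for q :: "'a list"
    by (cases q) auto
  then show ?thesis by (induction k) auto
qed

lemma traversals_Route_nth: "distinct p \<Longrightarrow> traversals (Route p) $ e = of_bool (e \<in> set p)"
  by (induction p) auto

text \<open>Rotation preserves edge counts, so the rotation selected by \<open>SOME\<close> is
  immaterial. From here on \<open>traversals (Route p)\<close> serves as the counting vector of any
  edge list, closed walks included.\<close>

lemma traversals_Band_rotations:
  "traversals (Band {rotate k p | k. True}) = traversals (Route p)"
proof -
  have "(SOME q. q \<in> {rotate k p | k. True}) \<in> {rotate k p | k. True}"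
    by (rule someI[of _ p]) (auto intro: exI[of _ 0])
  then obtain k where "(SOME q. q \<in> {rotate k p | k. True}) = rotate k p" by blast
  then show ?thesis by (simp add: count_list_rotate)
qed

text \<open>An incompatibility of a trail with itself needs two different edges of the trail that
  enter the same vertex. \<open>A\<close> stands for the edges of the trail.\<close>

lemma self_compatible_if_inj_on_head:
  assumes "\<And>s. s \<in> subpaths P \<Longrightarrow> set s \<subseteq> A" "inj_on (head G) A"
  shows "self_compatible G R P"
  unfolding self_compatible_def incompatible_def
proof (rule notI, elim bexE)
  fix p q assume pq: "p \<in> subpaths P" "q \<in> subpaths P" and "incompatibility G R p q"
  then obtain v r e1 e2 f1 f2 where
    e: "e1 \<in> in_arcs G v" "e2 \<in> in_arcs G v" "less_wrt (in_order R v) e1 e2"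
    and eq: "p = e1 # r @ [f2]" "q = e2 # r @ [f1]"
    unfolding incompatibility_def by blast
  have "e1 \<in> A" "e2 \<in> A" using assms(1)[OF pq(1)] assms(1)[OF pq(2)] eq by auto
  then have "e1 = e2" using e assms(2) by (auto simp: inj_on_def)
  then show False using e(3) by (simp add: less_wrt_def)
qed

section \<open>Simple routes and simple cycles as edge lists\<close>

locale flow_network = fin_digraph G for G :: "('a, 'b::finite) pre_digraph"
begin

definition simple_cycle :: "'b list \<Rightarrow> bool" where
  "simple_cycle p \<longleftrightarrow> closed_walk G p \<and> distinct (map (tail G) p)"

definition simple_route :: "'b list \<Rightarrow> bool" where
  "simple_route p \<longleftrightarrow> route G p \<and> distinct (map (tail G) p)"

lemma head_not_source: "e \<in> arcs G \<Longrightarrow> \<not> source G (head G e)"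
  by (auto simp: source_def in_arcs_def)

lemma tail_not_sink: "e \<in> arcs G \<Longrightarrow> \<not> sink G (tail G e)"
  by (auto simp: sink_def out_arcs_def)

lemma awalk_head_last: "awalk u p v \<Longrightarrow> p \<noteq> [] \<Longrightarrow> head G (last p) = v"
  by (induction p arbitrary: u) (auto simp: awalk_simps)

lemma awalk_tail_hd: "awalk u p v \<Longrightarrow> p \<noteq> [] \<Longrightarrow> tail G (hd p) = u"
  by (cases p) (auto simp: awalk_simps)

text \<open>The two notions differ only in the final vertex of the route, which is a sink and hence
  the tail of no edge.\<close>

lemma simple_Route_iff:
  assumes "route G p"
  shows "simple G (Route p) \<longleftrightarrow> simple_route p"
proof -
  obtain u v where p: "p \<noteq> []" "awalk u p v" "sink G v" using assms by (auto simp: route_def)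
  have "head G (last p) = v" using awalk_head_last p by blast
  then have "head G (last p) \<notin> tail G ` set p" using p tail_not_sink by (auto simp: awalk_def)
  then show ?thesis using p(1) assms by (simp add: awalk_verts_conv simple_route_def)
qed

lemma simple_route_inj_on_head:
  assumes "simple_route p"
  shows "inj_on (head G) (set p)"
proof -
  obtain u v where p: "p \<noteq> []" "awalk u p v"
    using assms by (auto simp: simple_route_def route_def)
  have "simple G (Route p)" using assms simple_Route_iff simple_route_def by blast
  then have "distinct (awalk_verts (tail G (hd p)) p)" by simp
  moreover have "awalk_verts (tail G (hd p)) p = tail G (hd p) # map (head G) p"
    using p awalk_verts_conv'[of "tail G (hd p)" p v] by (cases p) (auto simp: awalk_def)
  ultimately show ?thesis by (simp add: distinct_map)
qed

text \<open>Around a closed walk the heads are the tails shifted by one position, so distinct tails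
  give distinct heads.\<close>

lemma simple_cycle_inj_on_head:
  assumes "simple_cycle p"
  shows "inj_on (head G) (set p)"
proof -
  obtain u where p: "p \<noteq> []" "awalk u p u"
    using assms by (auto simp: simple_cycle_def closed_walk_def)
  have "awalk_verts u p = map (tail G) p @ [u]"
    using p(1) awalk_head_last[OF p(2,1)] by (simp add: awalk_verts_conv)
  moreover have "cas u p u" using p(2) by (simp add: awalk_def)
  ultimately have "u # map (head G) p = map (tail G) p @ [u]"
    using p(1) awalk_verts_conv' awalk_tail_hd[OF p(2,1)] by simp
  \<comment> \<open>Passing to multisets cancels the base point, which stands in front on one side
    and at the end on the other.\<close>
  then have "mset (u # map (head G) p) = mset (map (tail G) p @ [u])" by (rule arg_cong)
  then have "mset (map (head G) p) = mset (map (tail G) p)" by simp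
  then have "distinct (map (head G) p)"
    using assms mset_eq_imp_distinct_iff unfolding simple_cycle_def by blast
  then show ?thesis by (simp add: distinct_map)
qed

text \<open>With distinct tails, only one edge of the common edge set leaves the current vertex, so
  the next edge is forced in both walks.\<close>

lemma awalk_eqI:
  assumes "awalk u p v" "awalk u q w" "distinct (map (tail G) p)" "distinct (map (tail G) q)"
    and "set p = set q"
  shows "p = q"
  using assms
proof (induction p arbitrary: u q)
  case (Cons e p)
  obtain f q' where q: "q = f # q'" using Cons.prems(5) by (cases q) auto
  have ef: "tail G e = tail G f" using Cons.prems(1,2) q by (auto simp: awalk_Cons_iff)
  have "f \<in> set (e # p)" using Cons.prems(5) q by simp
  then have [simp]: "f = e" using Cons.prems(3) ef by auto
  have "e \<notin> set p" "e \<notin> set q'" using Cons.prems(3,4) q by auto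
  then have "set p = set q'" using Cons.prems(5) q by auto
  then show ?case using Cons q by (auto simp: awalk_Cons_iff)
qed simp

lemma closed_walk_rotate1: "closed_walk G p \<Longrightarrow> closed_walk G (rotate1 p)"
  by (cases p) (auto simp: closed_walk_def awalk_simps intro!: exI)

lemma closed_walk_rotate: "closed_walk G p \<Longrightarrow> closed_walk G (rotate k p)"
  by (induction k) (auto simp: closed_walk_rotate1)

lemma simple_cycle_rotate: "simple_cycle p \<Longrightarrow> simple_cycle (rotate k p)"
  by (simp add: simple_cycle_def closed_walk_rotate flip: rotate_map)

text \<open>Rotating \<open>q\<close> until it begins with the first edge of \<open>p\<close> gives
  both walks the same start, and \<open>awalk_eqI\<close> applies.\<close>

lemma rotation_if_same_arcs:
  assumes "simple_cycle p" "simple_cycle q" "set p = set q"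
  shows "\<exists>k. p = rotate k q"
proof -
  obtain u where u: "p \<noteq> []" "awalk u p u"
    using assms(1) by (auto simp: simple_cycle_def closed_walk_def)
  have "hd p \<in> set q" using u(1) assms(3) by (metis hd_in_set)
  then obtain xs ys where q: "q = xs @ hd p # ys" by (meson split_list)
  let ?q = "rotate (length xs) q"
  have q': "?q = hd p # ys @ xs" by (simp add: q rotate_append)
  have "simple_cycle ?q" using assms(2) by (rule simple_cycle_rotate)
  then obtain w where w: "awalk w ?q w" and d: "distinct (map (tail G) ?q)"
    by (auto simp: simple_cycle_def closed_walk_def)
  have "tail G (hd p) = u" by (rule awalk_tail_hd[OF u(2,1)])
  then have "w = u" using w unfolding q' by (simp add: awalk_Cons_iff)
  then have "p = ?q" using awalk_eqI[OF u(2) _ _ d] w assms(1,3) by (simp add: simple_cycle_def)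
  then show ?thesis by blast
qed

lemma rotations_eq_if_same_arcs:
  assumes "simple_cycle p" "simple_cycle q" "set p = set q"
  shows "{rotate k p | k. True} = {rotate k q | k. True}"
proof -
  have "{rotate k p | k. True} \<subseteq> {rotate k q | k. True}"
    if "simple_cycle p" "simple_cycle q" "set p = set q" for p q
    using rotation_if_same_arcs[OF that] by (auto simp: rotate_rotate)
  then show ?thesis using assms by (simp add: subset_antisym)
qed

lemma simple_cycle_band:
  assumes "simple_cycle p"
  shows "band G {rotate k p | k. True}"
proof -
  have "\<not> (closed_walk G q \<and> length q < length p \<and> p = list_power q n)" for q n
  proof
    assume q: "closed_walk G q \<and> length q < length p \<and> p = list_power q n"
    then have "q \<noteq> []" by (simp add: closed_walk_def)
    have "distinct p" using assms by (simp add: simple_cycle_def distinct_map)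
    \<comment> \<open>Exponents 0 and 1 contradict the lengths; a larger exponent would repeat the
      edges of \<open>q\<close>.\<close>
    consider "n = 0" | "n = 1" | m where "n = Suc (Suc m)"
      by (metis One_nat_def not0_implies_Suc)
    then show False
    proof cases
      case 3
      then have "p = q @ q @ list_power q m" using q by (simp add: list_power_def)
      then show False using \<open>distinct p\<close> \<open>q \<noteq> []\<close> by (cases q) auto
    qed (use q in \<open>auto simp: list_power_def\<close>)
  qed
  then have "primitive_closed_walk G p"
    using assms by (auto simp: primitive_closed_walk_def simple_cycle_def)
  then show ?thesis by (auto simp: band_def)
qed

section \<open>Elementary trails and their self-compatibility\<close>

lemma elementary_bands_eq:
  "elementary_bands G = {Band {rotate k p | k. True} | p. simple_cycle p}"
proof (intro equalityI subsetI)
  fix x assume "x \<in> elementary_bands G"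
  then obtain B where B: "x = Band B" "band G B" "\<forall>p\<in>B. distinct (map (tail G) p)"
    by (auto simp: elementary_bands_def)
  then obtain p where p: "primitive_closed_walk G p" "B = {rotate k p | k. True}"
    by (auto simp: band_def)
  have "p \<in> B" unfolding p(2) by (auto intro: exI[of _ 0])
  then have "simple_cycle p"
    using p(1) B(3) by (auto simp: simple_cycle_def primitive_closed_walk_def)
  then show "x \<in> {Band {rotate k p | k. True} | p. simple_cycle p}" using p(2) B(1) by blast
next
  fix x assume "x \<in> {Band {rotate k p | k. True} | p. simple_cycle p}"
  then obtain p where p: "x = Band {rotate k p | k. True}" "simple_cycle p" by blast
  have "distinct (map (tail G) (rotate k p))" for k
    using simple_cycle_rotate[OF p(2)] by (simp add: simple_cycle_def)
  then show "x \<in> elementary_bands G"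
    using simple_cycle_band[OF p(2)] by (auto simp: elementary_bands_def p(1))
qed

text \<open>Every subpath comes from a power of a rotation of \<open>p\<close>, so it uses only
  edges of \<open>p\<close>, whose heads are pairwise distinct.\<close>

lemma elementary_bands_self_compatible:
  assumes "B \<in> elementary_bands G"
  shows "self_compatible G R B"
proof -
  obtain p where p: "B = Band {rotate k p | k. True}" "simple_cycle p"
    using assms by (auto simp: elementary_bands_eq)
  show ?thesis
  proof (rule self_compatible_if_inj_on_head[of _ "set p"])
    fix s assume "s \<in> subpaths B"
    then obtain k n where "sublist s (list_power (rotate k p) n)" by (auto simp: p(1))
    then show "set s \<subseteq> set p"
      using set_mono_sublist set_list_power_subset[of "rotate k p" n] by fastforce
  qed (rule simple_cycle_inj_on_head[OF p(2)])
qed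

lemma elementary_routes_eq: "elementary_routes G R = {Route p | p. simple_route p}"
proof -
  have "self_compatible G R (Route p)" if "simple_route p" for p
    using simple_route_inj_on_head[OF that] set_mono_sublist
    by (intro self_compatible_if_inj_on_head[of _ "set p"]) auto
  moreover have "route G p \<and> simple G (Route p) \<longleftrightarrow> simple_route p" for p
    using simple_Route_iff simple_route_def by blast
  ultimately show ?thesis by (auto simp: elementary_routes_def simp del: simple.simps)
qed

section \<open>Simple trails in the support of a flow\<close>

text \<open>The hypotheses say that \<open>A\<close> has dead ends only at sources and sinks. A
  longest walk in \<open>A\<close> with distinct tails can be prolonged at any other end; the
  prolonged walk must repeat a tail, and this closes a cycle inside \<open>A\<close>.\<close>

lemma simple_trail_exists:
  assumes A: "A \<subseteq> arcs G" "A \<noteq> {}"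
    and prev: "\<And>e. e \<in> A \<Longrightarrow> source G (tail G e) \<or> (\<exists>f\<in>A. head G f = tail G e)"
    and succ: "\<And>e. e \<in> A \<Longrightarrow> sink G (head G e) \<or> (\<exists>f\<in>A. tail G f = head G e)"
  shows "\<exists>p. (simple_route p \<or> simple_cycle p) \<and> set p \<subseteq> A"
proof (rule ccontr)
  assume none: "\<not> ?thesis"
  define W where "W p \<longleftrightarrow> p \<noteq> [] \<and> set p \<subseteq> A \<and> distinct (map (tail G) p) \<and>
    (\<exists>u v. awalk u p v)" for p
  obtain a where "a \<in> A" using A(2) by blast
  then have "W [a]" using A(1) arc_implies_awalk by (auto simp: W_def)
  moreover have "length p < Suc (card A)" if "W p" for p
  proof -
    have "distinct p" "set p \<subseteq> A" using that by (auto simp: W_def distinct_map)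
    then show ?thesis using card_mono[of A "set p"] by (simp add: distinct_card)
  qed
  ultimately obtain p where p: "W p" and max: "\<And>q. W q \<Longrightarrow> length q \<le> length p"
    using ex_has_greatest_nat[of W "[a]" length "Suc (card A)"] by (metis less_imp_le)
  then obtain u v where p_ne: "p \<noteq> []" and pA: "set p \<subseteq> A" and pd: "distinct (map (tail G) p)"
    and pw: "awalk u p v" by (auto simp: W_def)
  have u: "tail G (hd p) = u" and v: "head G (last p) = v"
    using awalk_tail_hd awalk_head_last pw p_ne by blast+
  have "source G u"
  proof (rule ccontr)
    assume "\<not> source G u"
    then obtain e where e: "e \<in> A" "head G e = u"
      using prev[of "hd p"] u pA p_ne by (metis hd_in_set subsetD)
    have ew: "awalk (tail G e) (e # p) v" using e A(1) pw by (auto simp: awalk_Cons_iff)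
    then have "\<not> distinct (map (tail G) (e # p))"
      using max[of "e # p"] e pA by (auto simp: W_def simp del: distinct.simps list.map)
    \<comment> \<open>The new edge \<open>e\<close> starts where some edge \<open>f\<close> of
      \<open>p\<close> starts, so \<open>e\<close> followed by the part of \<open>p\<close> before
      \<open>f\<close> is closed.\<close>
    then obtain f where "f \<in> set p" "tail G f = tail G e" using pd by auto
    then obtain xs ys where xs: "p = xs @ f # ys" "f \<notin> set xs" by (meson split_list_first)
    have "awalk (tail G e) ((e # xs) @ f # ys) v" using ew xs by simp
    then have "awalk (tail G e) (e # xs) (tail G f)"
      unfolding awalk_append_iff by (metis awalk_Cons_iff)
    then have "closed_walk G (e # xs)"
      using \<open>tail G f = tail G e\<close> by (auto simp: closed_walk_def)
    moreover have "distinct (map (tail G) (e # xs))"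
      using pd xs \<open>tail G f = tail G e\<close> by auto
    ultimately have "simple_cycle (e # xs)" by (simp only: simple_cycle_def)
    moreover have "set (e # xs) \<subseteq> A" using e(1) pA xs by auto
    ultimately show False using none by blast
  qed
  moreover have "sink G v"
  proof (rule ccontr)
    assume "\<not> sink G v"
    then obtain e where e: "e \<in> A" "tail G e = v"
      using succ[of "last p"] v pA p_ne by (metis last_in_set subsetD)
    have ew: "awalk u (p @ [e]) (head G e)"
      using e A(1) pw by (intro awalk_appendI[OF pw]) (auto simp: awalk_simps)
    then have "\<not> distinct (map (tail G) (p @ [e]))"
      using max[of "p @ [e]"] e pA by (auto simp: W_def simp del: distinct_append map_append)
    then obtain f where f: "f \<in> set p" "tail G f = v" using pd e by auto
    then obtain xs ys where xs: "p = xs @ f # ys" by (meson split_list)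
    \<comment> \<open>At the far end the cycle is the part of \<open>p\<close> from \<open>f\<close>
      onwards; it already returns to \<open>v\<close> and does not contain the new edge.\<close>
    have "awalk v (f # ys) v" using pw f(2) unfolding xs awalk_append_iff
      by (metis awalk_Cons_iff)
    then have "closed_walk G (f # ys)" by (auto simp: closed_walk_def)
    moreover have "distinct (map (tail G) (f # ys))" using pd xs by simp
    ultimately have "simple_cycle (f # ys)" by (simp only: simple_cycle_def)
    moreover have "set (f # ys) \<subseteq> A" using pA xs by auto
    ultimately show False using none by blast
  qed
  ultimately have "simple_route p" using p_ne pw pd by (auto simp: simple_route_def route_def)
  then show False using none pA by blast
qed

text \<open>The conditions shared by unit flows and recession directions, which differ only in
  having source total 1 or 0.\<close>

definition nonneg_flow :: "real ^ 'b \<Rightarrow> bool" where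
  "nonneg_flow F \<longleftrightarrow> flow G F \<and> (\<forall>e. 0 \<le> F $ e)"

definition supp :: "real ^ 'b \<Rightarrow> 'b set" where
  "supp F = {e. F $ e \<noteq> 0}"

lemma supp_subset_arcs: "flow G F \<Longrightarrow> supp F \<subseteq> arcs G"
  by (auto simp: flow_def supp_def)

lemma flow_add: "flow G F \<Longrightarrow> flow G H \<Longrightarrow> flow G (F + H)"
  by (auto simp: flow_def sum.distrib)

lemma flow_scaleR: "flow G F \<Longrightarrow> flow G (c *\<^sub>R F)"
  by (auto simp: flow_def simp flip: sum_distrib_left)

lemma flow_diff: "flow G F \<Longrightarrow> flow G H \<Longrightarrow> flow G (F - H)"
  by (auto simp: flow_def sum_subtractf)

text \<open>The support has dead ends only at sources and sinks: if no supported edge enters an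
  internal vertex, its inflow and hence its outflow is 0, and by nonnegativity every edge leaving it
  carries 0. The same holds with directions exchanged.\<close>

lemma nonneg_flow_trail:
  assumes F: "nonneg_flow F" "F \<noteq> 0"
  shows "\<exists>p. (simple_route p \<or> simple_cycle p) \<and> set p \<subseteq> supp F"
proof (rule simple_trail_exists)
  have nn: "\<And>e. 0 \<le> F $ e" and fl: "flow G F" using F by (auto simp: nonneg_flow_def)
  show sub: "supp F \<subseteq> arcs G" by (rule supp_subset_arcs[OF fl])
  show "supp F \<noteq> {}" using F(2) by (auto simp: supp_def vec_eq_iff)
  have cons: "(\<Sum>e\<in>in_arcs G v. F $ e) = (\<Sum>e\<in>out_arcs G v. F $ e)" if "internal G v" for v
    using fl that by (simp add: flow_def)
  show "source G (tail G e) \<or> (\<exists>f\<in>supp F. head G f = tail G e)" if e: "e \<in> supp F" for e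
  proof (rule ccontr)
    assume "\<not> ?thesis"
    then have ns: "\<not> source G (tail G e)" and z: "\<And>f. head G f = tail G e \<Longrightarrow> F $ f = 0"
      by (auto simp: supp_def)
    have "internal G (tail G e)" using ns e sub tail_not_sink by (auto simp: internal_def)
    moreover have "(\<Sum>f\<in>in_arcs G (tail G e). F $ f) = 0"
      by (rule sum.neutral) (simp add: z)
    ultimately have "(\<Sum>f\<in>out_arcs G (tail G e). F $ f) = 0" using cons by simp
    then have "F $ e = 0" using e sub nn by (subst (asm) sum_nonneg_eq_0_iff) auto
    then show False using e by (simp add: supp_def)
  qed
  show "sink G (head G e) \<or> (\<exists>f\<in>supp F. tail G f = head G e)" if e: "e \<in> supp F" for e
  proof (rule ccontr)
    assume "\<not> ?thesis"
    then have ns: "\<not> sink G (head G e)" and z: "\<And>f. tail G f = head G e \<Longrightarrow> F $ f = 0"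
      by (auto simp: supp_def)
    have "internal G (head G e)" using ns e sub head_not_source by (auto simp: internal_def)
    moreover have "(\<Sum>f\<in>out_arcs G (head G e). F $ f) = 0"
      by (rule sum.neutral) (simp add: z)
    ultimately have "(\<Sum>f\<in>in_arcs G (head G e). F $ f) = 0" using cons by simp
    then have "F $ e = 0" using e sub nn by (subst (asm) sum_nonneg_eq_0_iff) auto
    then show False using e by (simp add: supp_def)
  qed
qed

section \<open>Flows along walks\<close>

lemma sum_count_list_Cons:
  "finite X \<Longrightarrow> (\<Sum>x\<in>X. real (count_list (e # p) x)) =
    of_bool (e \<in> X) + (\<Sum>x\<in>X. real (count_list p x))"
proof -
  assume "finite X"
  have "(\<Sum>x\<in>X. real (count_list (e # p) x)) =
      (\<Sum>x\<in>X. (if e = x then 1 else 0) + real (count_list p x))"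
    by (intro sum.cong) auto
  then show ?thesis using \<open>finite X\<close> by (simp add: sum.distrib)
qed

text \<open>Each traversed edge adds 1 at its head and subtracts 1 at its tail; along a walk these
  contributions telescope to its two ends.\<close>

lemma walk_balance:
  assumes "awalk u p w"
  shows "(\<Sum>e\<in>in_arcs G v. real (count_list p e)) - (\<Sum>e\<in>out_arcs G v. real (count_list p e)) =
    of_bool (w = v) - of_bool (u = v)"
  using assms
proof (induction p arbitrary: u)
  case (Cons e p)
  have "(\<Sum>e\<in>in_arcs G v. real (count_list p e)) - (\<Sum>e\<in>out_arcs G v. real (count_list p e)) =
    of_bool (w = v) - of_bool (head G e = v)"
    using Cons by (simp add: awalk_Cons_iff)
  moreover have "e \<in> arcs G" "u = tail G e" using Cons.prems by (auto simp: awalk_Cons_iff)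
  ultimately show ?case by (simp add: sum_count_list_Cons del: count_list.simps)
qed (simp add: awalk_Nil_iff)

text \<open>No edge enters a source, so only the first edge of a walk can leave one.\<close>

lemma source_total_walk:
  assumes "awalk u p w"
  shows "(\<Sum>e\<in>source_arcs G. real (count_list p e)) = of_bool (p \<noteq> [] \<and> source G u)"
  using assms
proof (induction p arbitrary: u)
  case (Cons e p)
  have "e \<in> arcs G" "u = tail G e" using Cons.prems by (auto simp: awalk_Cons_iff)
  then show ?case using Cons.IH[of "head G e"] Cons.prems head_not_source[of e]
    by (simp add: sum_count_list_Cons awalk_Cons_iff source_arcs_def del: count_list.simps)
qed simp

text \<open>By \<open>walk_balance\<close> only the ends could violate conservation; they either
  cancel or are not internal.\<close>

lemma walk_flow:
  assumes "awalk u p w" "u = w \<or> source G u \<and> sink G w"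
  shows "flow G (traversals (Route p))"
  unfolding flow_def
proof (intro conjI allI impI)
  fix e assume "e \<notin> arcs G"
  then have "e \<notin> set p" using assms(1) by (auto simp: awalk_def)
  then show "traversals (Route p) $ e = 0" by simp
next
  fix v assume "internal G v"
  then have "of_bool (w = v) = (of_bool (u = v) :: real)"
    using assms(2) by (auto simp: internal_def)
  then show "(\<Sum>e\<in>in_arcs G v. traversals (Route p) $ e) =
      (\<Sum>e\<in>out_arcs G v. traversals (Route p) $ e)"
    using walk_balance[OF assms(1), of v] by simp
qed

section \<open>Vectors of simple trails and the flows that contain them\<close>

lemma distinct_simple:
  "simple_route p \<Longrightarrow> distinct p" "simple_cycle p \<Longrightarrow> distinct p"
  by (auto simp: simple_route_def simple_cycle_def distinct_map)

lemma supp_traversals: "supp (traversals (Route p)) = set p"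
  by (auto simp: supp_def count_list_0_iff)

lemma nonneg_flow_simple_route:
  assumes "simple_route p"
  shows "nonneg_flow (traversals (Route p))" "traversals (Route p) \<in> unit_flows G"
proof -
  obtain u v where p: "p \<noteq> []" "source G u" "sink G v" "awalk u p v"
    using assms by (auto simp: simple_route_def route_def)
  show nf: "nonneg_flow (traversals (Route p))"
    using walk_flow[OF p(4)] p(2,3) by (simp add: nonneg_flow_def)
  show "traversals (Route p) \<in> unit_flows G"
    using nf source_total_walk[OF p(4)] p(1,2) by (simp add: unit_flows_def nonneg_flow_def)
qed

text \<open>Homogenising replaces the source total 1 by 0. The argument reads off the inequalities,
  so it also covers the case in which there are no unit flows.\<close>

lemma recession_cone_flow_system:
  "F \<in> recession_cone (flow_system G) \<longleftrightarrow> nonneg_flow F \<and> (\<Sum>e\<in>source_arcs G. F $ e) = 0"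
proof -
  have "F \<in> recession_cone (flow_system G) \<longleftrightarrow>
      (\<forall>e. - axis e 1 \<bullet> F \<le> 0) \<and> (\<forall>e. e \<notin> arcs G \<longrightarrow> axis e 1 \<bullet> F \<le> 0) \<and>
      (\<forall>v. internal G v \<longrightarrow> conservation G v \<bullet> F \<le> 0) \<and>
      (\<forall>v. internal G v \<longrightarrow> - conservation G v \<bullet> F \<le> 0) \<and>
      source_total G \<bullet> F \<le> 0 \<and> - source_total G \<bullet> F \<le> 0"
    unfolding recession_cone_def flow_system_def by blast
  then show ?thesis
    unfolding nonneg_flow_def flow_def
    by (auto simp: inner_conservation inner_source_total inner_axis' intro: antisym)
qed

lemma simple_cycle_in_recession_cone:
  assumes "simple_cycle p"
  shows "traversals (Route p) \<in> recession_cone (flow_system G)"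
proof -
  obtain u where p: "p \<noteq> []" "awalk u p u"
    using assms by (auto simp: simple_cycle_def closed_walk_def)
  have "last p \<in> arcs G" using p by (auto simp: awalk_def)
  then have "\<not> source G u" using head_not_source awalk_head_last[OF p(2,1)] by blast
  then show ?thesis
    using walk_flow[OF p(2)] source_total_walk[OF p(2)]
    by (simp add: recession_cone_flow_system nonneg_flow_def)
qed

text \<open>Source total 0 and nonnegativity make \<open>F\<close> vanish on all source edges. This
  excludes a route in the support, since its first edge leaves a source.\<close>

lemma recession_cone_cycle:
  assumes F: "F \<in> recession_cone (flow_system G)" "F \<noteq> 0"
  shows "\<exists>p. simple_cycle p \<and> set p \<subseteq> supp F"
proof -
  have nf: "nonneg_flow F" and s: "(\<Sum>e\<in>source_arcs G. F $ e) = 0"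
    using F(1) by (auto simp: recession_cone_flow_system)
  have z: "F $ e = 0" if "e \<in> source_arcs G" for e
    using s nf that by (subst (asm) sum_nonneg_eq_0_iff) (auto simp: nonneg_flow_def)
  obtain p where p: "simple_route p \<or> simple_cycle p" "set p \<subseteq> supp F"
    using nonneg_flow_trail[OF nf F(2)] by blast
  have "\<not> simple_route p"
  proof
    assume "simple_route p"
    then obtain u v where uv: "p \<noteq> []" "source G u" "awalk u p v"
      by (auto simp: simple_route_def route_def)
    then have "hd p \<in> source_arcs G" by (cases p) (auto simp: awalk_Cons_iff source_arcs_def)
    moreover have "hd p \<in> supp F" using uv(1) p(2) by (meson hd_in_set subsetD)
    ultimately show False using z by (simp add: supp_def)
  qed
  then show ?thesis using p by blast
qed

text \<open>Where two consecutive edges of the walk meet, they are the only edges of the support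
  entering and leaving, so conservation gives them equal values. This treats routes and cycles
  alike.\<close>

lemma flow_on_simple_walk:
  assumes w: "awalk u p v" "p \<noteq> []" "distinct (map (tail G) p)" "inj_on (head G) (set p)"
    and x: "flow G x" "supp x \<subseteq> set p"
  shows "x = (x $ hd p) *\<^sub>R traversals (Route p)"
proof -
  have step: "x $ e = x $ f" if ef: "e \<in> set p" "f \<in> set p" "head G e = tail G f" for e f
  proof -
    have arcs: "e \<in> arcs G" "f \<in> arcs G" using w(1) ef by (auto simp: awalk_def)
    have "internal G (head G e)"
      using arcs head_not_source[of e] tail_not_sink[of f] ef(3) head_in_verts[of e]
      by (simp add: internal_def)
    then have "(\<Sum>g\<in>in_arcs G (head G e). x $ g) = (\<Sum>g\<in>out_arcs G (head G e). x $ g)"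
      using x(1) by (simp add: flow_def)
    moreover have "(\<Sum>g\<in>in_arcs G (head G e). x $ g) = (\<Sum>g\<in>{e}. x $ g)"
      using arcs ef(1) w(4) x(2)
      by (intro sum.mono_neutral_right) (auto simp: supp_def inj_on_def)
    moreover have "inj_on (tail G) (set p)" using w(3) by (simp add: distinct_map)
    then have "(\<Sum>g\<in>out_arcs G (head G e). x $ g) = (\<Sum>g\<in>{f}. x $ g)"
      using arcs ef x(2)
      by (intro sum.mono_neutral_right) (auto simp: supp_def inj_on_def)
    ultimately show ?thesis by simp
  qed
  \<comment> \<open>The induction removes first edges, so the claim is made for every walk to
    \<open>v\<close> with edges in \<open>p\<close>, from any start.\<close>
  have const: "\<forall>e\<in>set q. x $ e = x $ hd q" if "awalk u q v" "set q \<subseteq> set p" for u q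
    using that
  proof (induction q arbitrary: u)
    case (Cons e q)
    show ?case
    proof (cases q)
      case q: (Cons f r)
      have "x $ f = x $ e" using Cons.prems q by (intro step[symmetric]) (auto simp: awalk_simps)
      then show ?thesis using Cons.IH[of "head G e"] Cons.prems q by (auto simp: awalk_Cons_iff)
    qed simp
  qed simp
  have "distinct p" using w(3) by (simp add: distinct_map)
  then show ?thesis
    unfolding vec_eq_iff vector_scaleR_component traversals_Route_nth[OF \<open>distinct p\<close>]
    using const[OF w(1)] x(2) by (auto simp: supp_def)
qed

text \<open>The multiple is the least value of \<open>F\<close> on \<open>p\<close>: values stay
  nonnegative, and an edge attaining the minimum leaves the support.\<close>

lemma nonneg_flow_subtract:
  assumes F: "nonneg_flow F" and p: "p \<noteq> []" "distinct p" "set p \<subseteq> supp F"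
    and fl: "flow G (traversals (Route p))"
  obtains c where "c > 0" "nonneg_flow (F - c *\<^sub>R traversals (Route p))"
    "supp (F - c *\<^sub>R traversals (Route p)) \<subset> supp F"
proof
  let ?c = "Min (($) F ` set p)"
  let ?H = "F - ?c *\<^sub>R traversals (Route p)"
  have H: "?H $ e = F $ e - ?c * of_bool (e \<in> set p)" for e
    by (simp only: vector_minus_component vector_scaleR_component traversals_Route_nth[OF p(2)]
        real_scaleR_def)
  have pos: "F $ e > 0" if "e \<in> set p" for e
    using F p(3) that by (force simp: nonneg_flow_def supp_def less_le)
  show "?c > 0" using p(1) pos by (subst Min_gr_iff) auto
  have le: "?c \<le> F $ e" if "e \<in> set p" for e using that by (intro Min_le) auto
  show "nonneg_flow ?H"
    using F fl le by (auto simp only: nonneg_flow_def H flow_diff flow_scaleR) auto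
  have "?c \<in> ($) F ` set p" using p(1) by (intro Min_in) auto
  then obtain e where e: "e \<in> set p" "?c = F $ e" by blast
  have "e \<notin> supp ?H" unfolding supp_def mem_Collect_eq H using e by simp
  moreover have "supp ?H \<subseteq> supp F"
    using p(3) unfolding supp_def H by auto
  ultimately show "supp ?H \<subset> supp F" using e(1) p(3) by blast
qed

section \<open>Vertices of the polyhedron of unit flows\<close>

lemma unit_flows_iff:
  "F \<in> unit_flows G \<longleftrightarrow> nonneg_flow F \<and> (\<Sum>e\<in>source_arcs G. F $ e) = 1"
  by (auto simp: unit_flows_def nonneg_flow_def)

lemma source_total_scaleR:
  "(\<Sum>e\<in>source_arcs G. (c *\<^sub>R F) $ e) = c * (\<Sum>e\<in>source_arcs G. F $ e)"
  by (simp add: sum_distrib_left)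

text \<open>A flow supported on the route is a multiple of its vector, and comparing source totals
  shows the factor to be 1.\<close>

lemma simple_route_flow:
  assumes p: "simple_route p" and x: "x \<in> unit_flows G" "supp x \<subseteq> set p"
  shows "x = traversals (Route p)"
proof -
  obtain u v where w: "awalk u p v" "p \<noteq> []"
    using p by (auto simp: simple_route_def route_def)
  have "distinct (map (tail G) p)" using p by (simp add: simple_route_def)
  then have eq: "x = (x $ hd p) *\<^sub>R traversals (Route p)" (is "x = ?c *\<^sub>R ?T")
    using flow_on_simple_walk[OF w] simple_route_inj_on_head[OF p] x
    by (simp add: unit_flows_def)
  have "?c * (\<Sum>e\<in>source_arcs G. ?T $ e) = 1"
    using x(1) eq source_total_scaleR by (metis unit_flows_iff)
  then have "?c = 1"
    using nonneg_flow_simple_route(2)[OF p] by (simp add: unit_flows_iff del: traversals.simps)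
  then show ?thesis using eq by simp
qed

lemma simple_route_extreme:
  assumes p: "simple_route p"
  shows "traversals (Route p) extreme_point_of unit_flows G"
  unfolding extreme_point_of_def
proof (intro conjI ballI notI)
  let ?T = "traversals (Route p)"
  show "?T \<in> unit_flows G" by (rule nonneg_flow_simple_route(2)[OF p])
  fix a b assume ab: "a \<in> unit_flows G" "b \<in> unit_flows G" and "?T \<in> open_segment a b"
  then obtain t where t: "0 < t" "t < 1" "?T = (1 - t) *\<^sub>R a + t *\<^sub>R b" and "a \<noteq> b"
    by (auto simp: in_segment)
  have nn: "0 \<le> a $ e" "0 \<le> b $ e" for e using ab by (auto simp: unit_flows_def)
  \<comment> \<open>Nonnegative terms with positive weights cannot cancel, so off the route both
    endpoints vanish; each then equals the route vector.\<close>
  have "a $ e = 0 \<and> b $ e = 0" if "e \<notin> set p" for e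
  proof -
    have "e \<notin> supp ?T" using that by (simp only: supp_traversals not_False_eq_True)
    then have "(1 - t) * a $ e + t * b $ e = 0" by (simp add: supp_def t(3) del: traversals.simps)
    moreover have "0 \<le> (1 - t) * a $ e" "0 \<le> t * b $ e" using t nn by simp_all
    ultimately have "(1 - t) * a $ e = 0" "t * b $ e = 0" by linarith+
    then show ?thesis using t by simp
  qed
  then have "supp a \<subseteq> set p" "supp b \<subseteq> set p" by (auto simp: supp_def)
  then have "a = ?T" "b = ?T" using simple_route_flow[OF p] ab by blast+
  then show False using \<open>a \<noteq> b\<close> by simp
qed

text \<open>A cycle has source total 0, so a small multiple of it can be both added and subtracted
  within the unit flows, making \<open>F\<close> a proper midpoint.\<close>

lemma extreme_no_cycle:
  assumes ext: "F extreme_point_of unit_flows G" and p: "simple_cycle p"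
  shows "\<not> set p \<subseteq> supp F"
proof
  assume sub: "set p \<subseteq> supp F"
  let ?T = "traversals (Route p)"
  have F: "nonneg_flow F" "(\<Sum>e\<in>source_arcs G. F $ e) = 1"
    using ext by (auto simp: extreme_point_of_def unit_flows_iff)
  have T: "nonneg_flow ?T" "(\<Sum>e\<in>source_arcs G. ?T $ e) = 0"
    using simple_cycle_in_recession_cone[OF p] by (auto simp only: recession_cone_flow_system)
  have ne: "p \<noteq> []" using p by (auto simp: simple_cycle_def closed_walk_def)
  have "flow G ?T" using T(1) by (simp only: nonneg_flow_def)
  then obtain c where c: "c > 0" "nonneg_flow (F - c *\<^sub>R ?T)"
    using nonneg_flow_subtract[OF F(1) ne distinct_simple(2)[OF p] sub] by metis
  have "F - c *\<^sub>R ?T \<in> unit_flows G"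
    using c F T(2) unfolding unit_flows_iff
    by (simp add: sum_subtractf del: traversals.simps flip: sum_distrib_left)
  moreover have "F + c *\<^sub>R ?T \<in> unit_flows G"
    using c F T unfolding unit_flows_iff
    by (simp add: sum.distrib nonneg_flow_def flow_add flow_scaleR del: traversals.simps
        flip: sum_distrib_left)
  moreover have "F \<in> open_segment (F - c *\<^sub>R ?T) (F + c *\<^sub>R ?T)"
  proof -
    have "?T \<noteq> 0" using supp_traversals[of p] ne by (auto simp: supp_def simp del: traversals.simps)
    then have "F - c *\<^sub>R ?T \<noteq> F + c *\<^sub>R ?T" using c(1)
      by (simp add: eq_commute[of "_ - _"] algebra_simps add_eq_0_iff2 del: traversals.simps
          flip: scaleR_2)
    moreover have "F = (1 - 1/2) *\<^sub>R (F - c *\<^sub>R ?T) + (1/2) *\<^sub>R (F + c *\<^sub>R ?T)"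
      by (simp add: scaleR_diff_right scaleR_add_right del: traversals.simps flip: scaleR_left_distrib)
    ultimately show ?thesis unfolding in_segment
      by (intro conjI exI[of _ "1/2"]) auto
  qed
  ultimately show False using ext by (auto simp: extreme_point_of_def)
qed

lemma extreme_is_simple_route:
  assumes ext: "F extreme_point_of unit_flows G"
  shows "\<exists>p. simple_route p \<and> F = traversals (Route p)"
proof -
  have F: "nonneg_flow F" "(\<Sum>e\<in>source_arcs G. F $ e) = 1"
    using ext by (auto simp: extreme_point_of_def unit_flows_iff)
  then have "F \<noteq> 0" by auto
  then obtain p where p: "simple_route p" "set p \<subseteq> supp F"
    using nonneg_flow_trail[OF F(1)] extreme_no_cycle[OF ext] by blast
  let ?T = "traversals (Route p)"
  have T: "nonneg_flow ?T" "?T \<in> unit_flows G" "(\<Sum>e\<in>source_arcs G. ?T $ e) = 1"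
    using nonneg_flow_simple_route[OF p(1)] by (auto simp only: unit_flows_iff)
  have ne: "p \<noteq> []" using p by (auto simp: simple_route_def route_def)
  have "flow G ?T" using T(1) by (simp only: nonneg_flow_def)
  then obtain c where c: "c > 0" "nonneg_flow (F - c *\<^sub>R ?T)" "supp (F - c *\<^sub>R ?T) \<subset> supp F"
    using nonneg_flow_subtract[OF F(1) ne distinct_simple(1)[OF p(1)] p(2)] by metis
  let ?H = "F - c *\<^sub>R ?T"
  have st: "(\<Sum>e\<in>source_arcs G. ?H $ e) = 1 - c"
    using F(2) T(3) by (simp add: sum_subtractf del: traversals.simps flip: sum_distrib_left)
  moreover have "(\<Sum>e\<in>source_arcs G. ?H $ e) \<ge> 0"
    using c(2) by (intro sum_nonneg) (simp only: nonneg_flow_def)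
  \<comment> \<open>If \<open>c = 1\<close>, the remainder lies in the recession cone and, unless 0,
    would put a cycle into the support of \<open>F\<close>. If \<open>c < 1\<close>, the remainder
    can be normalised.\<close>
  ultimately have "c \<le> 1" by simp
  show ?thesis
  proof (cases "c = 1")
    case True
    have "?H = 0"
    proof (rule ccontr)
      assume "?H \<noteq> 0"
      moreover have "?H \<in> recession_cone (flow_system G)"
        using c(2) st True unfolding recession_cone_flow_system by simp
      ultimately show False using recession_cone_cycle c(3) extreme_no_cycle[OF ext] by blast
    qed
    then show ?thesis using True p(1) by (intro exI[of _ p]) (simp del: traversals.simps)
  next
    case False
    then have "c < 1" using \<open>c \<le> 1\<close> by simp
    \<comment> \<open>\<open>K\<close> is the remainder rescaled to source total 1, so
      \<open>F\<close> is a proper convex combination of \<open>K\<close> and the route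
      vector.\<close>
    define K where "K = (1 / (1 - c)) *\<^sub>R ?H"
    have "K \<in> unit_flows G"
      using c(2) \<open>c < 1\<close> st unfolding unit_flows_iff K_def source_total_scaleR
      by (auto simp only: nonneg_flow_def flow_scaleR) (simp_all del: traversals.simps)
    moreover have eq: "F = (1 - c) *\<^sub>R K + c *\<^sub>R ?T"
      using \<open>c < 1\<close> by (simp add: K_def del: traversals.simps)
    then have "F \<in> open_segment K ?T" if "K \<noteq> ?T"
      using that c(1) \<open>c < 1\<close> unfolding in_segment by blast
    ultimately have "K = ?T" using ext T(2) by (auto simp: extreme_point_of_def)
    then have "F = ?T" using eq by (simp del: traversals.simps flip: scaleR_left_distrib)
    then show ?thesis using p(1) by blast
  qed
qed

lemma bij_betw_elementary_routes:
  "bij_betw traversals (elementary_routes G R) {x. x extreme_point_of unit_flows G}"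
  unfolding bij_betw_def
proof
  show "inj_on traversals (elementary_routes G R)"
    unfolding elementary_routes_eq
  proof (rule inj_onI, clarsimp simp del: traversals.simps)
    fix p q assume pq: "simple_route p" "simple_route q"
      "traversals (Route p) = traversals (Route q)"
    then have eq: "set p = set q" using supp_traversals by metis
    obtain u v where u: "source G u" "p \<noteq> []" "awalk u p v"
      using pq(1) by (auto simp: simple_route_def route_def)
    obtain u' v' where u': "awalk u' q v'"
      using pq(2) by (auto simp: simple_route_def route_def)
    \<comment> \<open>Both routes start at the same vertex: \<open>u\<close> lies on
      \<open>q\<close>, and being a source it is the head of no edge, so it must be the start of
      \<open>q\<close>.\<close>
    have "hd p \<in> set q" using u(2) eq by (metis hd_in_set)
    moreover have "tail G (hd p) = u" by (rule awalk_tail_hd[OF u(3,2)])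
    ultimately have "u \<in> set (awalk_verts u' q)" using awalk_verts_arc1 by blast
    then have "u = u' \<or> u \<in> head G ` set q"
      using awalk_verts_conv'[of u' q v'] u' by (cases q) (auto simp: awalk_def)
    moreover have "u \<notin> head G ` set q"
      using u(1) u' head_not_source by (auto simp: awalk_def)
    ultimately show "p = q"
      using awalk_eqI[OF u(3) _ _ _ eq] u' pq(1,2) by (simp add: simple_route_def)
  qed
  show "traversals ` elementary_routes G R = {x. x extreme_point_of unit_flows G}"
    unfolding elementary_routes_eq
    using simple_route_extreme extreme_is_simple_route by blast
qed

section \<open>Extremal rays of the recession cone\<close>

lemma convex_cone_recession_cone: "convex_cone (recession_cone (flow_system G))"
  by (auto simp: convex_cone_iff recession_cone_def inner_add_right mult_nonneg_nonpos
      intro!: add_nonpos_nonpos)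

text \<open>Induction on the size of the support: a nonzero direction contains a cycle, and
  subtracting a suitable multiple of it shrinks the support.\<close>

lemma recession_cone_generated:
  "convex_cone hull {traversals (Route p) | p. simple_cycle p} = recession_cone (flow_system G)"
  (is "convex_cone hull ?E = ?C")
proof (rule antisym)
  show "convex_cone hull ?E \<subseteq> ?C"
    using simple_cycle_in_recession_cone convex_cone_recession_cone
    by (intro hull_minimal) blast+
  have "F \<in> convex_cone hull ?E" if "F \<in> ?C" for F
    using that
  proof (induction "card (supp F)" arbitrary: F rule: less_induct)
    case less
    show ?case
    proof (cases "F = 0")
      case True
      then show ?thesis by (simp only: convex_cone_hull_contains_0)
    next
      case False
      then obtain p where p: "simple_cycle p" "set p \<subseteq> supp F"
        using recession_cone_cycle less.prems by blast
      let ?T = "traversals (Route p)"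
      have F: "nonneg_flow F" "(\<Sum>e\<in>source_arcs G. F $ e) = 0"
        using less.prems by (auto simp: recession_cone_flow_system)
      have T: "nonneg_flow ?T" "(\<Sum>e\<in>source_arcs G. ?T $ e) = 0"
        using simple_cycle_in_recession_cone[OF p(1)] by (auto simp only: recession_cone_flow_system)
      have ne: "p \<noteq> []" using p by (auto simp: simple_cycle_def closed_walk_def)
      have "flow G ?T" using T(1) by (simp only: nonneg_flow_def)
      then obtain c where c: "c > 0" "nonneg_flow (F - c *\<^sub>R ?T)"
          "supp (F - c *\<^sub>R ?T) \<subset> supp F"
        using nonneg_flow_subtract[OF F(1) ne distinct_simple(2)[OF p(1)] p(2)] by metis
      have "F - c *\<^sub>R ?T \<in> ?C"
        using c(2) F(2) T(2) unfolding recession_cone_flow_system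
        by (simp add: sum_subtractf del: traversals.simps flip: sum_distrib_left)
      then have "F - c *\<^sub>R ?T \<in> convex_cone hull ?E"
        using less.hyps c(3) by (simp add: psubset_card_mono del: traversals.simps)
      moreover have "c *\<^sub>R ?T \<in> convex_cone hull ?E"
        using p(1) c(1) by (intro convex_cone_hull_mul hull_inc) auto
      ultimately have "(F - c *\<^sub>R ?T) + c *\<^sub>R ?T \<in> convex_cone hull ?E"
        by (rule convex_cone_hull_add)
      then show ?thesis by (simp only: diff_add_cancel)
    qed
  qed
  then show "?C \<subseteq> convex_cone hull ?E" by blast
qed

text \<open>Nonnegative summands of a multiple of the cycle vector are supported on the cycle, hence
  are multiples of it themselves.\<close>

lemma cycle_summand:
  assumes p: "simple_cycle p"
    and x: "x \<in> recession_cone (flow_system G)" and y: "y \<in> recession_cone (flow_system G)"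
    and xy: "x + y \<in> ray (traversals (Route p))"
  shows "x = 0 \<or> x \<in> ray (traversals (Route p))"
proof -
  let ?T = "traversals (Route p)"
  obtain u where w: "awalk u p u" "p \<noteq> []"
    using p by (auto simp: simple_cycle_def closed_walk_def)
  obtain c where c: "x + y = c *\<^sub>R ?T" using xy by (auto simp: ray_def)
  have nn: "0 \<le> x $ e" "0 \<le> y $ e" for e
    using x y by (auto simp: recession_cone_flow_system nonneg_flow_def)
  have "x $ e = 0" if "e \<notin> set p" for e
  proof -
    have "e \<notin> supp ?T" using that by (simp only: supp_traversals not_False_eq_True)
    then have "x $ e + y $ e = 0" using c
      by (metis (mono_tags) mem_Collect_eq supp_def vector_add_component
          vector_scaleR_component scaleR_zero_right)
    then show ?thesis using nn[of e] by linarith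
  qed
  then have "supp x \<subseteq> set p" by (auto simp: supp_def)
  moreover have "flow G x" using x by (auto simp: recession_cone_flow_system nonneg_flow_def)
  moreover have "distinct (map (tail G) p)" using p by (simp add: simple_cycle_def)
  ultimately have "x = (x $ hd p) *\<^sub>R ?T"
    using flow_on_simple_walk[OF w] simple_cycle_inj_on_head[OF p] by blast
  then show ?thesis
    using nn(1)[of "hd p"] unfolding ray_def
    by (metis (mono_tags, lifting) less_le mem_Collect_eq scaleR_zero_left)
qed

text \<open>Supplies the extremality hypothesis of \<open>extremal_rays_eqI\<close>.\<close>

lemma convex_cone_diff_ray:
  assumes p: "simple_cycle p"
  shows "convex_cone (recession_cone (flow_system G) - ray (traversals (Route p)))"
proof -
  let ?T = "traversals (Route p)" and ?C = "recession_cone (flow_system G)"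
  have ne: "p \<noteq> []" using p by (auto simp: simple_cycle_def closed_walk_def)
  have "?T \<noteq> 0" using supp_traversals[of p] ne by (auto simp: supp_def simp del: traversals.simps)
  then have 0: "0 \<notin> ray ?T" by (auto simp: ray_def simp del: traversals.simps)
  note cc = convex_cone_recession_cone
  show ?thesis
    unfolding convex_cone_iff
  proof (intro conjI ballI allI impI)
    show "0 \<in> ?C - ray ?T" using 0 convex_cone_contains_0[OF cc] by blast
  next
    fix x y assume xy: "x \<in> ?C - ray ?T" "y \<in> ?C - ray ?T"
    have "x + y \<notin> ray ?T"
    proof
      assume s: "x + y \<in> ray ?T"
      \<comment> \<open>Since \<open>x\<close> is off the ray, \<open>cycle_summand\<close> leaves
        only 0, and then \<open>y\<close> would lie on the ray.\<close>
      then have "x = 0" using cycle_summand[OF p] xy by blast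
      then show False using s xy by simp
    qed
    then show "x + y \<in> ?C - ray ?T" using xy convex_cone_add[OF cc] by blast
  next
    fix x and c :: real assume x: "x \<in> ?C - ray ?T" and c: "0 \<le> c"
    have "c *\<^sub>R x \<notin> ray ?T"
    proof
      assume s: "c *\<^sub>R x \<in> ray ?T"
      then have "c > 0" using c 0 by (cases "c = 0") auto
      then have "c *\<^sub>R x \<in> ray x" by (auto simp: ray_def)
      then have "x \<in> ray ?T" using ray_eqI[OF s] ray_eqI[of "c *\<^sub>R x" x] ray_self[of x] by simp
      then show False using x by simp
    qed
    then show "c *\<^sub>R x \<in> ?C - ray ?T" using x c convex_cone_scaleR[OF cc] by blast
  qed
qed

lemma same_arcs_if_same_ray:
  fixes p q :: "'b list"
  assumes "ray (traversals (Route p)) = ray (traversals (Route q))"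
  shows "set p = set q"
proof -
  have "traversals (Route p) \<in> ray (traversals (Route q))" using ray_self assms by blast
  then obtain c where "c > 0" "traversals (Route p) = c *\<^sub>R traversals (Route q)"
    by (auto simp: ray_def)
  then have "supp (traversals (Route p)) = supp (traversals (Route q))"
    by (simp add: supp_def del: traversals.simps)
  then show ?thesis by (simp only: supp_traversals)
qed

lemma extremal_rays_recession_cone:
  "extremal_rays (recession_cone (flow_system G)) =
    ray ` {traversals (Route p) | p. simple_cycle p}"
proof (rule extremal_rays_eqI[OF recession_cone_generated])
  show "inj_on ray {traversals (Route p) | p. simple_cycle p}"
  proof (rule inj_onI)
    fix x y
    assume "x \<in> {traversals (Route p) | p. simple_cycle p}"
      "y \<in> {traversals (Route p) | p. simple_cycle p}" and r: "ray x = ray y"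
    then obtain p q where pq: "simple_cycle p" "simple_cycle q"
      and xy: "x = traversals (Route p)" "y = traversals (Route q)" by blast
    \<comment> \<open>Vectors of simple cycles have entries 0 and 1, so the edge set determines
      them.\<close>
    have "set p = set q" using same_arcs_if_same_ray r xy by blast
    then show "x = y"
      using pq distinct_simple(2)
      by (simp add: xy vec_eq_iff traversals_Route_nth del: traversals.simps)
  qed
qed (use convex_cone_diff_ray in blast)

text \<open>For injectivity, the ray determines the edge set, and the edge set determines the cycle
  up to rotation, which is the band.\<close>

lemma bij_betw_elementary_bands:
  "bij_betw (\<lambda>B. ray (traversals B)) (elementary_bands G)
    (extremal_rays (recession_cone (flow_system G)))"
  unfolding bij_betw_def
proof
  show "inj_on (\<lambda>B. ray (traversals B)) (elementary_bands G)"
  proof (rule inj_onI)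
    fix x y assume "x \<in> elementary_bands G" "y \<in> elementary_bands G"
      and r: "ray (traversals x) = ray (traversals y)"
    then obtain p q where pq: "simple_cycle p" "simple_cycle q"
      and xy: "x = Band {rotate k p | k. True}" "y = Band {rotate k q | k. True}"
      unfolding elementary_bands_eq by blast
    have "set p = set q"
      using r same_arcs_if_same_ray unfolding xy traversals_Band_rotations by blast
    then show "x = y" using rotations_eq_if_same_arcs[OF pq] xy by simp
  qed
  have "(\<lambda>B. ray (traversals B)) ` elementary_bands G =
      {ray (traversals (Band {rotate k p | k. True})) | p. simple_cycle p}"
    unfolding elementary_bands_eq by blast
  then show "(\<lambda>B. ray (traversals B)) ` elementary_bands G =
      extremal_rays (recession_cone (flow_system G))"
    unfolding extremal_rays_recession_cone traversals_Band_rotations by blast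
qed

end

theorem theorem9p4:
  fixes G :: "('a, 'b::finite) pre_digraph" and R :: "('a, 'b) framing"
  assumes "fin_digraph G" and "is_framing G R"
  shows "bij_betw traversals (elementary_routes G R) {x. x extreme_point_of unit_flows G}
    \<and> bij_betw (\<lambda>B. ray (traversals B)) {B \<in> elementary_bands G. self_compatible G R B}
        (extremal_rays (recession_cone (flow_system G)))"
proof -
  interpret flow_network G using assms(1) by (simp add: flow_network_def)
  have "{B \<in> elementary_bands G. self_compatible G R B} = elementary_bands G"
    using elementary_bands_self_compatible by blast
  then show ?thesis using bij_betw_elementary_routes bij_betw_elementary_bands by simp
qed

end
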